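(* The pure cactus group $PJ_4$ admits the one-relator presentation $PJ_4=\langle \alpha,\beta,\gamma,\delta,\epsilon \mid \alpha\gamma\epsilon\beta\epsilon\alpha^{-1}\delta^{-1}\beta\gamma\delta^{-1}=1\rangle$, where, as elements of $J_4$, $\alpha=(s_{1,3}s_{1,2})^3$, $\beta=s_{1,2}s_{1,3}s_{1,4}s_{1,3}s_{1,4}s_{1,2}s_{1,4}$, $\gamma=s_{1,2}s_{1,4}s_{1,2}(s_{1,3}s_{1,4})^2$, $\delta=s_{1,3}(s_{1,2}s_{1,4})^2s_{1,3}s_{1,4}$, $\epsilon=(s_{1,4}s_{1,2}s_{1,3}s_{1,2})^2$.
   Context: For $n \ge 2$, the cactus group $J_n$ is the group with generators $s_{p,q}$ for $1 \le p < q \le n$ and relations: (j1) $s_{p,q}^2 = 1$; (j2) $s_{p,q}s_{m,r} = s_{m,r}s_{p,q}$ whenever $[p,q]\cap[m,r]=\emptyset$; (j3) $s_{p,q}s_{m,r} = s_{p+q-r,\,p+q-m}\,s_{p,q}$ whenever $[m,r]\subset[p,q]$. There is a homomorphism $s\colon J_n\to S_n$ sending $s_{p,q}$ to the permutation of $\{1,\dots,n\}$ that reverses the order of $p,p+1,\dots,q$ and fixes all other elements. The pure cactus group $PJ_n$ is the kernel of $s$. *)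

theory Defs
  imports "HOL-Algebra.Sym_Groups"
begin

section \<open>Groups given by generators and relations\<close>

text \<open>
  A letter \<open>(x, True)\<close> stands for the generator \<open>x\<close> and \<open>(x, False)\<close> for its formal inverse.
  A relation \<open>u = v\<close> is a pair \<open>(u, v)\<close> of words.
\<close>

type_synonym 'a word = "('a \<times> bool) list"

definition words :: "'a set \<Rightarrow> 'a word set"
  where "words X = lists (X \<times> UNIV)"

inductive_set pres_cong :: "'a set \<Rightarrow> ('a word \<times> 'a word) set \<Rightarrow> ('a word \<times> 'a word) set"
  for X :: "'a set" and R :: "('a word \<times> 'a word) set" where
  relation: "\<lbrakk>(u, v) \<in> R; u \<in> words X; v \<in> words X\<rbrakk> \<Longrightarrow> (u, v) \<in> pres_cong X R"
| cancel: "x \<in> X \<Longrightarrow> ([(x, b), (x, \<not> b)], []) \<in> pres_cong X R"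
| refl: "u \<in> words X \<Longrightarrow> (u, u) \<in> pres_cong X R"
| sym: "(u, v) \<in> pres_cong X R \<Longrightarrow> (v, u) \<in> pres_cong X R"
| trans: "\<lbrakk>(u, v) \<in> pres_cong X R; (v, w) \<in> pres_cong X R\<rbrakk> \<Longrightarrow> (u, w) \<in> pres_cong X R"
| append: "\<lbrakk>(u, u') \<in> pres_cong X R; (v, v') \<in> pres_cong X R\<rbrakk> \<Longrightarrow> (u @ v, u' @ v') \<in> pres_cong X R"

definition pres_class :: "'a set \<Rightarrow> ('a word \<times> 'a word) set \<Rightarrow> 'a word \<Rightarrow> 'a word set"
  where "pres_class X R w = pres_cong X R `` {w}"

definition presented_group :: "'a set \<Rightarrow> ('a word \<times> 'a word) set \<Rightarrow> 'a word set monoid"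
  where "presented_group X R =
    \<lparr>carrier = words X // pres_cong X R,
     mult = (\<lambda>A B. \<Union>u\<in>A. \<Union>v\<in>B. pres_class X R (u @ v)),
     one = pres_class X R []\<rparr>"

definition pres_gen :: "'a set \<Rightarrow> ('a word \<times> 'a word) set \<Rightarrow> 'a \<Rightarrow> 'a word set"
  where "pres_gen X R x = pres_class X R [(x, True)]"

definition word_val :: "('g, 'm) monoid_scheme \<Rightarrow> ('a \<Rightarrow> 'g) \<Rightarrow> 'a word \<Rightarrow> 'g"
  where "word_val G f w =
    foldr (\<lambda>(x, b) g. (if b then f x else inv\<^bsub>G\<^esub> f x) \<otimes>\<^bsub>G\<^esub> g) w \<one>\<^bsub>G\<^esub>"

text \<open>
  The homomorphism out of a presented group induced by an assignment \<open>f\<close> of the generators;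
  it is well defined when \<open>f\<close> respects the relations, see \<open>pres_lift_hom\<close> below.
\<close>

definition pres_lift :: "('g, 'm) monoid_scheme \<Rightarrow> ('a \<Rightarrow> 'g) \<Rightarrow> 'a word set \<Rightarrow> 'g"
  where "pres_lift G f A = the_elem (word_val G f ` A)"

lemma words_simps [simp]:
  "[] \<in> words X"
  "a # w \<in> words X \<longleftrightarrow> fst a \<in> X \<and> w \<in> words X"
  "u @ v \<in> words X \<longleftrightarrow> u \<in> words X \<and> v \<in> words X"
  by (cases a; auto simp: words_def)+

lemma pres_cong_words:
  assumes "(u, v) \<in> pres_cong X R"
  shows "u \<in> words X \<and> v \<in> words X"
  using assms by induction auto

lemma equiv_pres_cong: "equiv (words X) (pres_cong X R)"
proof (rule equivI)
  show "pres_cong X R \<subseteq> words X \<times> words X"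
    using pres_cong_words by fastforce
  show "refl_on (words X) (pres_cong X R)"
    by (auto intro!: refl_onI pres_cong.refl dest: pres_cong_words)
  show "sym (pres_cong X R)"
    by (auto intro: symI pres_cong.sym)
  show "trans (pres_cong X R)"
    by (auto intro: transI pres_cong.trans)
qed

lemma pres_class_eq:
  assumes "u \<in> words X" and "v \<in> words X"
  shows "pres_class X R u = pres_class X R v \<longleftrightarrow> (u, v) \<in> pres_cong X R"
  unfolding pres_class_def using eq_equiv_class_iff[OF equiv_pres_cong assms] .

lemma carrier_presented_group: "carrier (presented_group X R) = pres_class X R ` words X"
  by (auto simp: presented_group_def pres_class_def quotient_def)

lemma one_presented_group: "\<one>\<^bsub>presented_group X R\<^esub> = pres_class X R []"
  by (simp add: presented_group_def)

lemma mult_pres_class: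
  assumes "u \<in> words X" and "v \<in> words X"
  shows "pres_class X R u \<otimes>\<^bsub>presented_group X R\<^esub> pres_class X R v = pres_class X R (u @ v)"
proof -
  have "pres_class X R (u' @ v') = pres_class X R (u @ v)"
    if "u' \<in> pres_class X R u" "v' \<in> pres_class X R v" for u' v'
  proof -
    have "(u, u') \<in> pres_cong X R" "(v, v') \<in> pres_cong X R"
      using that by (auto simp: pres_class_def)
    then have "(u @ v, u' @ v') \<in> pres_cong X R"
      by (rule pres_cong.append)
    then show ?thesis
      using pres_class_eq pres_cong_words by blast
  qed
  moreover have "u \<in> pres_class X R u" "v \<in> pres_class X R v"
    using assms by (auto simp: pres_class_def intro: pres_cong.refl)
  ultimately have "(\<Union>u'\<in>pres_class X R u. \<Union>v'\<in>pres_class X R v. pres_class X R (u' @ v'))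
      = pres_class X R (u @ v)"
    by blast
  then show ?thesis
    by (simp add: presented_group_def)
qed

lemma group_presented_group: "group (presented_group X R)"
proof (rule groupI)
  fix A assume "A \<in> carrier (presented_group X R)"
  then obtain u where u: "u \<in> words X" "A = pres_class X R u"
    by (auto simp: carrier_presented_group)
  have "\<exists>v \<in> words X. (v @ u, []) \<in> pres_cong X R"
    using u(1)
  proof (induction u)
    case Nil
    show ?case by (rule bexI[of _ "[]"]) (auto intro: pres_cong.refl)
  next
    case (Cons a u)
    then obtain v where v: "v \<in> words X" "(v @ u, []) \<in> pres_cong X R"
      by auto
    obtain x b where a: "a = (x, b)" by (cases a)
    have x: "x \<in> X" using Cons.prems a by simp
    have "([(x, \<not> b), (x, b)], []) \<in> pres_cong X R"
      using pres_cong.cancel[OF x, of "\<not> b"] by simp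
    then have "(v @ [(x, \<not> b), (x, b)], v @ []) \<in> pres_cong X R"
      by (rule pres_cong.append[OF pres_cong.refl[OF v(1)]])
    moreover have "(u, u) \<in> pres_cong X R"
      using Cons.prems by (auto intro: pres_cong.refl)
    ultimately have "((v @ [(x, \<not> b), (x, b)]) @ u, (v @ []) @ u) \<in> pres_cong X R"
      by (rule pres_cong.append)
    then have "((v @ [(x, \<not> b)]) @ a # u, []) \<in> pres_cong X R"
      using pres_cong.trans[OF _ v(2)] a by simp
    moreover have "v @ [(x, \<not> b)] \<in> words X" using v x by simp
    ultimately show ?case by blast
  qed
  then obtain v where "v \<in> words X" "(v @ u, []) \<in> pres_cong X R"
    by blast
  then show "\<exists>B\<in>carrier (presented_group X R). B \<otimes>\<^bsub>presented_group X R\<^esub> A = \<one>\<^bsub>presented_group X R\<^esub>"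
    using u
    by (intro bexI[of _ "pres_class X R v"])
      (auto simp: mult_pres_class one_presented_group pres_class_eq carrier_presented_group)
qed (auto simp: carrier_presented_group one_presented_group mult_pres_class)

lemma (in group) word_val_closed:
  assumes "f \<in> X \<rightarrow> carrier G" and "w \<in> words X"
  shows "word_val G f w \<in> carrier G"
  using assms(2)
proof (induction w)
  case (Cons a w)
  then show ?case using assms(1) by (cases a) (auto simp: word_val_def)
qed (simp add: word_val_def)

lemma (in group) word_val_append:
  assumes f: "f \<in> X \<rightarrow> carrier G" and "u \<in> words X" and v: "v \<in> words X"
  shows "word_val G f (u @ v) = word_val G f u \<otimes> word_val G f v"
  using assms(2)
proof (induction u)
  case Nil
  then show ?case using word_val_closed[OF f v] by (simp add: word_val_def)
next
  case (Cons a u)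
  obtain x b where a: "a = (x, b)" by (cases a)
  have "f x \<in> carrier G" "word_val G f u \<in> carrier G"
    using f Cons.prems a word_val_closed[OF f] by auto
  then show ?case
    using Cons a word_val_closed[OF f v] by (auto simp: word_val_def m_assoc)
qed

lemma (in group) word_val_cong:
  assumes f: "f \<in> X \<rightarrow> carrier G"
    and rel: "\<And>u v. (u, v) \<in> R \<Longrightarrow> word_val G f u = word_val G f v"
    and "(u, v) \<in> pres_cong X R"
  shows "word_val G f u = word_val G f v"
  using assms(3)
proof induction
  case (cancel x b)
  then have "f x \<in> carrier G" using f by auto
  then show ?case by (simp add: word_val_def)
next
  case (append u u' v v')
  then show ?case
    using word_val_append[OF f] pres_cong_words by metis
qed (simp_all add: rel)

lemma (in group) pres_lift_class:
  assumes "f \<in> X \<rightarrow> carrier G"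
    and "\<And>u v. (u, v) \<in> R \<Longrightarrow> word_val G f u = word_val G f v"
    and "w \<in> words X"
  shows "pres_lift G f (pres_class X R w) = word_val G f w"
proof -
  have "w \<in> pres_class X R w"
    using pres_cong.refl[OF assms(3)] by (simp add: pres_class_def)
  moreover have "word_val G f v = word_val G f w" if "v \<in> pres_class X R w" for v
    using word_val_cong[OF assms(1,2), of R w v] that by (simp add: pres_class_def)
  ultimately have "word_val G f ` pres_class X R w = {word_val G f w}"
    by blast
  then show ?thesis by (simp add: pres_lift_def)
qed

lemma (in group) pres_lift_hom:
  assumes "f \<in> X \<rightarrow> carrier G"
    and "\<And>u v. (u, v) \<in> R \<Longrightarrow> word_val G f u = word_val G f v"
  shows "pres_lift G f \<in> hom (presented_group X R) G"
    and "x \<in> X \<Longrightarrow> pres_lift G f (pres_gen X R x) = f x"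
proof -
  show "pres_lift G f \<in> hom (presented_group X R) G"
    by (auto intro!: homI simp: carrier_presented_group mult_pres_class
        pres_lift_class[OF assms] word_val_closed[OF assms(1)] word_val_append[OF assms(1)])
  show "pres_lift G f (pres_gen X R x) = f x" if "x \<in> X"
  proof -
    have "f x \<in> carrier G" using that assms(1) by auto
    then show ?thesis
      using that by (simp add: pres_gen_def pres_lift_class[OF assms] word_val_def)
  qed
qed


section \<open>Cactus groups\<close>

definition cactus_gens :: "nat \<Rightarrow> (nat \<times> nat) set"
  where "cactus_gens n = {(p, q). 1 \<le> p \<and> p < q \<and> q \<le> n}"

definition cactus_rels :: "nat \<Rightarrow> ((nat \<times> nat) word \<times> (nat \<times> nat) word) set"
  where "cactus_rels n =
    {([((p, q), True), ((p, q), True)], []) | p q. (p, q) \<in> cactus_gens n}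
    \<union> {([((p, q), True), ((m, r), True)], [((m, r), True), ((p, q), True)]) | p q m r.
        (p, q) \<in> cactus_gens n \<and> (m, r) \<in> cactus_gens n \<and> {p..q} \<inter> {m..r} = {}}
    \<union> {([((p, q), True), ((m, r), True)], [((p + q - r, p + q - m), True), ((p, q), True)]) | p q m r.
        (p, q) \<in> cactus_gens n \<and> (m, r) \<in> cactus_gens n \<and> {m..r} \<subseteq> {p..q}}"

definition cactus_group :: "nat \<Rightarrow> (nat \<times> nat) word set monoid"
  where "cactus_group n = presented_group (cactus_gens n) (cactus_rels n)"

definition cactus_gen :: "nat \<Rightarrow> nat \<Rightarrow> nat \<Rightarrow> (nat \<times> nat) word set"
  where "cactus_gen n p q = pres_gen (cactus_gens n) (cactus_rels n) (p, q)"

definition interval_reversal :: "nat \<times> nat \<Rightarrow> nat \<Rightarrow> nat"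
  where "interval_reversal = (\<lambda>(p, q) i. if p \<le> i \<and> i \<le> q then p + q - i else i)"

definition cactus_perm :: "nat \<Rightarrow> (nat \<times> nat) word set \<Rightarrow> nat \<Rightarrow> nat"
  where "cactus_perm n = pres_lift (sym_group n) interval_reversal"

definition pure_cactus_group :: "nat \<Rightarrow> (nat \<times> nat) word set monoid"
  where "pure_cactus_group n =
    (cactus_group n)\<lparr>carrier := kernel (cactus_group n) (sym_group n) (cactus_perm n)\<rparr>"

lemma group_cactus_group: "group (cactus_group n)"
  by (simp add: cactus_group_def group_presented_group)

lemma interval_reversal_permutes:
  assumes "(p, q) \<in> cactus_gens n"
  shows "interval_reversal (p, q) permutes {1..n}"
proof (rule bij_imp_permutes)
  have "interval_reversal (p, q) (interval_reversal (p, q) i) = i" for i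
    by (auto simp: interval_reversal_def)
  moreover have "interval_reversal (p, q) i \<in> {1..n}" if "i \<in> {1..n}" for i
    using that assms by (auto simp: interval_reversal_def cactus_gens_def)
  ultimately show "bij_betw (interval_reversal (p, q)) {1..n} {1..n}"
    by (intro bij_betwI[where g = "interval_reversal (p, q)"]) auto
  show "\<And>i. i \<notin> {1..n} \<Longrightarrow> interval_reversal (p, q) i = i"
    using assms by (auto simp: interval_reversal_def cactus_gens_def)
qed

lemma interval_reversal_cactus_rels:
  assumes "(u, v) \<in> cactus_rels n"
  shows "word_val (sym_group n) interval_reversal u = word_val (sym_group n) interval_reversal v"
proof -
  have J1: "interval_reversal (p, q) \<circ> interval_reversal (p, q) = id" for p q
    by (auto simp: interval_reversal_def fun_eq_iff)
  have J2: "interval_reversal (p, q) \<circ> interval_reversal (m, r)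
      = interval_reversal (m, r) \<circ> interval_reversal (p, q)"
    if "p < q" "m < r" "m \<le> q \<longrightarrow> \<not> p \<le> r" for p q m r
  proof -
    have "q < m \<or> r < p"
      using that by auto
    then show ?thesis
      using that(1,2) by (auto simp: interval_reversal_def fun_eq_iff)
  qed
  have J3: "interval_reversal (p, q) \<circ> interval_reversal (m, r)
      = interval_reversal (p + q - r, p + q - m) \<circ> interval_reversal (p, q)"
    if "m < r" "{m..r} \<subseteq> {p..q}" for p q m r
  proof -
    have "p \<le> m" "r \<le> q"
      using that by auto
    with that(1) show ?thesis
      by (auto simp: interval_reversal_def fun_eq_iff)
  qed
  show ?thesis
    using assms unfolding cactus_rels_def
    by (elim UnE CollectE exE conjE)
      (auto simp: word_val_def sym_group_def J1 J3 cactus_gens_def intro: J2)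
qed

lemma cactus_perm_hom: "cactus_perm n \<in> hom (cactus_group n) (sym_group n)"
  and cactus_perm_gen:
    "(p, q) \<in> cactus_gens n \<Longrightarrow> cactus_perm n (cactus_gen n p q) = interval_reversal (p, q)"
proof -
  have f: "interval_reversal \<in> cactus_gens n \<rightarrow> carrier (sym_group n)"
    by (auto simp: sym_group_carrier simp del: One_nat_def intro: interval_reversal_permutes)
  show "cactus_perm n \<in> hom (cactus_group n) (sym_group n)"
    unfolding cactus_perm_def cactus_group_def
    by (rule group.pres_lift_hom(1)[OF sym_group_is_group f interval_reversal_cactus_rels])
  show "cactus_perm n (cactus_gen n p q) = interval_reversal (p, q)" if "(p, q) \<in> cactus_gens n"
    unfolding cactus_perm_def cactus_gen_def
    by (rule group.pres_lift_hom(2)[OF sym_group_is_group f interval_reversal_cactus_rels that])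
qed

lemma group_pure_cactus_group: "group (pure_cactus_group n)"
proof -
  interpret group_hom "cactus_group n" "sym_group n" "cactus_perm n"
    by (intro group_hom.intro group_hom_axioms.intro group_cactus_group sym_group_is_group
        cactus_perm_hom)
  show ?thesis
    unfolding pure_cactus_group_def
    by (rule subgroup.subgroup_is_group[OF subgroup_kernel group_cactus_group])
qed


section \<open>The generators and the relation for the pure cactus group on four strands\<close>

datatype pj4_symbol = Alpha | Beta | Gamma | Delta | Epsilon

definition pj4_relator :: "pj4_symbol word"
  where "pj4_relator =
    [(Alpha, True), (Gamma, True), (Epsilon, True), (Beta, True), (Epsilon, True),
     (Alpha, False), (Delta, False), (Beta, True), (Gamma, True), (Delta, False)]"

abbreviation J4 :: "(nat \<times> nat) word set monoid"
  where "J4 \<equiv> cactus_group 4"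

abbreviation s4 :: "nat \<Rightarrow> nat \<Rightarrow> (nat \<times> nat) word set"
  where "s4 \<equiv> cactus_gen 4"

primrec pj4_element :: "pj4_symbol \<Rightarrow> (nat \<times> nat) word set" where
  "pj4_element Alpha = (s4 1 3 \<otimes>\<^bsub>J4\<^esub> s4 1 2) [^]\<^bsub>J4\<^esub> (3::nat)"
| "pj4_element Beta = s4 1 2 \<otimes>\<^bsub>J4\<^esub> s4 1 3 \<otimes>\<^bsub>J4\<^esub> s4 1 4 \<otimes>\<^bsub>J4\<^esub> s4 1 3 \<otimes>\<^bsub>J4\<^esub> s4 1 4
      \<otimes>\<^bsub>J4\<^esub> s4 1 2 \<otimes>\<^bsub>J4\<^esub> s4 1 4"
| "pj4_element Gamma = s4 1 2 \<otimes>\<^bsub>J4\<^esub> s4 1 4 \<otimes>\<^bsub>J4\<^esub> s4 1 2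
      \<otimes>\<^bsub>J4\<^esub> (s4 1 3 \<otimes>\<^bsub>J4\<^esub> s4 1 4) [^]\<^bsub>J4\<^esub> (2::nat)"
| "pj4_element Delta = s4 1 3 \<otimes>\<^bsub>J4\<^esub> (s4 1 2 \<otimes>\<^bsub>J4\<^esub> s4 1 4) [^]\<^bsub>J4\<^esub> (2::nat)
      \<otimes>\<^bsub>J4\<^esub> s4 1 3 \<otimes>\<^bsub>J4\<^esub> s4 1 4"
| "pj4_element Epsilon =
      (s4 1 4 \<otimes>\<^bsub>J4\<^esub> s4 1 2 \<otimes>\<^bsub>J4\<^esub> s4 1 3 \<otimes>\<^bsub>J4\<^esub> s4 1 2) [^]\<^bsub>J4\<^esub> (2::nat)"

end

(*
  A presentation of a finite-index subgroup is verified by the Reidemeister-Schreier method read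
  backwards. Let P be the one-relator group. The generators s_{p,q} act on S_4 x P by
  s (c, g) = (s c, w_s(c) g) for suitable words w_s(c), and this action satisfies the cactus
  relations. An element g of P, sent to J_4, moves (1, 1) to (1, g), so P embeds in J_4. Conversely
  s t(c) = t(s c) w_s(c) for a transversal t of PJ_4, so an element of PJ_4 that moves (1, 1) to
  (1, g) is the image of g. The Schreier graph on the generators s_{1,q} has 36 edges, 23 of them
  in a spanning tree; the remaining 13 carry the words w_s(c). All the required identities are
  found by rewriting.
*)

theory Submission
  imports Defs
begin

section \<open>Calculating with words\<close>

definition inv_word :: "'a word \<Rightarrow> 'a word"
  where "inv_word w = rev (map (\<lambda>(x, b). (x, \<not> b)) w)"

lemma inv_word_simps [simp]:
  "inv_word [] = []"
  "inv_word ((x, b) # w) = inv_word w @ [(x, \<not> b)]"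
  "inv_word (u @ v) = inv_word v @ inv_word u"
  by (simp_all add: inv_word_def)

lemma inv_word_inv_word [simp]: "inv_word (inv_word w) = w"
  by (induction w) (auto simp: inv_word_def)

lemma inv_word_words [simp]: "inv_word w \<in> words X \<longleftrightarrow> w \<in> words X"
  by (induction w) auto

lemma pres_cong_context:
  assumes "(v, v') \<in> pres_cong X R" and "u \<in> words X" and "w \<in> words X"
  shows "(u @ v @ w, u @ v' @ w) \<in> pres_cong X R"
  using assms by (intro pres_cong.append pres_cong.refl)

lemma pres_cong_inv_word_right:
  assumes "w \<in> words X"
  shows "(w @ inv_word w, []) \<in> pres_cong X R"
  using assms
proof (induction w)
  case Nil
  show ?case by (simp add: pres_cong.refl)
next
  case (Cons a w)
  obtain x b where a: "a = (x, b)" by (cases a)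
  have "([a] @ (w @ inv_word w) @ [(x, \<not> b)], [a] @ [] @ [(x, \<not> b)]) \<in> pres_cong X R"
    using Cons a by (intro pres_cong_context) auto
  moreover have "([a] @ [] @ [(x, \<not> b)], []) \<in> pres_cong X R"
    using Cons.prems a by (auto intro: pres_cong.cancel)
  ultimately show ?case
    using a by (auto intro: pres_cong.trans)
qed

lemma pres_cong_inv_word_left:
  assumes "w \<in> words X"
  shows "(inv_word w @ w, []) \<in> pres_cong X R"
  using pres_cong_inv_word_right[of "inv_word w"] assms by simp

text \<open>This turns every identity to be verified into the reduction of one word to the empty
  word.\<close>

lemma pres_cong_if_quotient:
  assumes "(u @ inv_word v, []) \<in> pres_cong X R"
  shows "(u, v) \<in> pres_cong X R"
proof -
  have words: "u \<in> words X" "v \<in> words X"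
    using pres_cong_words[OF assms] by auto
  have "(u @ [], u @ inv_word v @ v) \<in> pres_cong X R"
    using words by (intro pres_cong.append pres_cong.refl pres_cong.sym[OF pres_cong_inv_word_left])
  moreover have "((u @ inv_word v) @ v, [] @ v) \<in> pres_cong X R"
    using words assms by (intro pres_cong.append pres_cong.refl)
  ultimately show ?thesis
    by (auto intro: pres_cong.trans)
qed

lemma pres_cong_inv_word:
  assumes "(u, v) \<in> pres_cong X R"
  shows "(inv_word u, inv_word v) \<in> pres_cong X R"
proof (rule pres_cong_if_quotient)
  have words: "u \<in> words X" "v \<in> words X"
    using pres_cong_words[OF assms] by auto
  have "(inv_word u @ v, inv_word u @ u) \<in> pres_cong X R"
    using words assms by (intro pres_cong.append pres_cong.refl pres_cong.sym[OF assms]) auto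
  then show "(inv_word u @ inv_word (inv_word v), []) \<in> pres_cong X R"
    using words by (auto intro: pres_cong.trans pres_cong_inv_word_left)
qed

text \<open>From \<open>u v = 1\<close> follows \<open>u = v^{-1}\<close>, hence
  \<open>v u = 1\<close>. Iterated, this lets a relator be read from any starting letter.\<close>

lemma pres_cong_conjugate:
  assumes "(u @ v, []) \<in> pres_cong X R"
  shows "(v @ u, []) \<in> pres_cong X R"
proof -
  have words: "u \<in> words X" "v \<in> words X"
    using pres_cong_words[OF assms] by auto
  have "(u @ inv_word (inv_word v), []) \<in> pres_cong X R"
    using assms by simp
  then have "(u, inv_word v) \<in> pres_cong X R"
    by (rule pres_cong_if_quotient)
  then have "(v @ u, v @ inv_word v) \<in> pres_cong X R"
    using words by (intro pres_cong.append pres_cong.refl)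
  then show ?thesis
    using words by (auto intro: pres_cong.trans pres_cong_inv_word_right)
qed

lemma pres_cong_rotate:
  assumes "(w, []) \<in> pres_cong X R"
  shows "(rotate n w, []) \<in> pres_cong X R"
  using assms pres_cong_conjugate[of "take (n mod length w) w" "drop (n mod length w) w"]
  by (simp add: rotate_drop_take)

lemma inv_pres_class:
  assumes "w \<in> words X"
  shows "inv\<^bsub>presented_group X R\<^esub> pres_class X R w = pres_class X R (inv_word w)"
proof (rule group.inv_equality[OF group_presented_group])
  show "pres_class X R (inv_word w) \<otimes>\<^bsub>presented_group X R\<^esub> pres_class X R w
      = \<one>\<^bsub>presented_group X R\<^esub>"
    using assms pres_cong_inv_word_left[OF assms]
    by (simp add: mult_pres_class one_presented_group pres_class_eq)
qed (use assms in \<open>auto simp: carrier_presented_group\<close>)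

text \<open>The homomorphism of free groups that extends \<open>\<phi>\<close>, kept at the level of
  words so that it can be evaluated.\<close>

definition subst_word :: "('b \<Rightarrow> 'a word) \<Rightarrow> 'b word \<Rightarrow> 'a word"
  where "subst_word \<phi> w = concat (map (\<lambda>(y, b). if b then \<phi> y else inv_word (\<phi> y)) w)"

lemma subst_word_simps [simp]:
  "subst_word \<phi> [] = []"
  "subst_word \<phi> ((y, b) # w) = (if b then \<phi> y else inv_word (\<phi> y)) @ subst_word \<phi> w"
  "subst_word \<phi> (u @ v) = subst_word \<phi> u @ subst_word \<phi> v"
  by (simp_all add: subst_word_def)

lemma subst_word_words:
  assumes "\<And>y. y \<in> Y \<Longrightarrow> \<phi> y \<in> words X" and "w \<in> words Y"
  shows "subst_word \<phi> w \<in> words X"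
  using assms(2) by (induction w) (auto simp: assms(1))

lemma word_val_pres_class:
  assumes "\<And>y. y \<in> Y \<Longrightarrow> \<phi> y \<in> words X" and "w \<in> words Y"
  shows "word_val (presented_group X R) (\<lambda>y. pres_class X R (\<phi> y)) w
    = pres_class X R (subst_word \<phi> w)"
  using assms(2)
proof (induction w)
  case (Cons a w)
  obtain y b where a: "a = (y, b)" by (cases a)
  have "\<phi> y \<in> words X" "subst_word \<phi> w \<in> words X"
    using Cons.prems a assms(1) subst_word_words[OF assms(1)] by auto
  then show ?case
    using Cons a by (auto simp: word_val_def mult_pres_class inv_pres_class)
qed (simp add: word_val_def one_presented_group)


section \<open>Rewriting of words\<close>

fun strip_prefix :: "'a list \<Rightarrow> 'a list \<Rightarrow> 'a list option" where
  "strip_prefix [] ys = Some ys"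
| "strip_prefix (x # xs) [] = None"
| "strip_prefix (x # xs) (y # ys) = (if x = y then strip_prefix xs ys else None)"

fun apply_rule :: "('a list \<times> 'a list) list \<Rightarrow> 'a list \<Rightarrow> ('a list \<times> 'a list) option" where
  "apply_rule [] st = None"
| "apply_rule ((l, r) # rs) st =
    (case strip_prefix l st of None \<Rightarrow> apply_rule rs st | Some st' \<Rightarrow> Some (st', r))"

text \<open>
  The part of the word that has been read is kept reversed on a stack. Accordingly, the left-hand
  sides of the rules are reversed. The first argument bounds the number of steps.
\<close>

fun reduce :: "nat \<Rightarrow> ('a list \<times> 'a list) list \<Rightarrow> 'a list \<Rightarrow> 'a list \<Rightarrow> 'a list" where
  "reduce 0 rs st w = rev st @ w"
| "reduce (Suc n) rs st [] = rev st"
| "reduce (Suc n) rs st (a # w) =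
    (case apply_rule rs (a # st) of
      None \<Rightarrow> reduce n rs (a # st) w
    | Some (st', r) \<Rightarrow> reduce n rs st' (r @ w))"

lemma strip_prefix_Some: "strip_prefix xs ys = Some zs \<Longrightarrow> ys = xs @ zs"
  by (induction xs ys rule: strip_prefix.induct) (auto split: if_splits)

lemma apply_rule_Some:
  assumes "apply_rule rs st = Some (st', r)"
  shows "\<exists>l. (l, r) \<in> set rs \<and> st = l @ st'"
  using assms
proof (induction rs)
  case (Cons p rs)
  obtain l r' where p: "p = (l, r')" by (cases p)
  show ?case
  proof (cases "strip_prefix l st")
    case None
    then show ?thesis using Cons p by auto
  next
    case (Some st'')
    then show ?thesis using Cons.prems p strip_prefix_Some[OF Some] by auto
  qed
qed simp

lemma words_rev [simp]: "rev w \<in> words X \<longleftrightarrow> w \<in> words X"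
  by (induction w) auto

text \<open>Every step replaces a factor by a congruent one, so soundness is independent of
  termination and confluence. When the step bound is exhausted, the unread input is appended
  unchanged.\<close>

lemma pres_cong_reduce:
  assumes rules: "\<And>l r. (l, r) \<in> set rs \<Longrightarrow> (rev l, r) \<in> pres_cong X R"
    and "st \<in> words X" and "w \<in> words X"
  shows "(rev st @ w, reduce n rs st w) \<in> pres_cong X R"
  using assms(2,3)
proof (induction n arbitrary: st w)
  case 0
  then show ?case by (simp add: pres_cong.refl)
next
  case (Suc n)
  show ?case
  proof (cases w)
    case Nil
    then show ?thesis using Suc.prems by (simp add: pres_cong.refl)
  next
    case w: (Cons a v)
    show ?thesis
    proof (cases "apply_rule rs (a # st)")
      case None
      then show ?thesis using Suc.IH[of "a # st" v] Suc.prems w by simp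
    next
      case (Some p)
      obtain st' r where p: "p = (st', r)" by (cases p)
      obtain l where l: "(l, r) \<in> set rs" "a # st = l @ st'"
        using apply_rule_Some[of rs "a # st" st' r] Some p by auto
      have lr: "(rev l, r) \<in> pres_cong X R"
        using rules l(1) .
      have "l @ st' \<in> words X"
        unfolding l(2)[symmetric] using Suc.prems w by simp
      then have words: "st' \<in> words X" "v \<in> words X" "r \<in> words X"
        using Suc.prems w pres_cong_words[OF lr] by auto
      have "rev st @ w = rev (a # st) @ v"
        using w by simp
      also have "\<dots> = rev st' @ rev l @ v"
        unfolding l(2) by simp
      finally have "(rev st @ w, rev st' @ r @ v) \<in> pres_cong X R"
        using pres_cong_context[OF lr, of "rev st'" v] words by simp
      moreover have "(rev st' @ r @ v, reduce n rs st' (r @ v)) \<in> pres_cong X R"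
        using Suc.IH[of st' "r @ v"] words by simp
      ultimately show ?thesis
        using w Some p by (auto intro: pres_cong.trans)
    qed
  qed
qed

lemma pres_cong_if_reduce:
  assumes "\<And>l r. (l, r) \<in> set rs \<Longrightarrow> (rev l, r) \<in> pres_cong X R"
    and "u \<in> words X" and "v \<in> words X"
    and "reduce n rs [] (u @ inv_word v) = []"
  shows "(u, v) \<in> pres_cong X R"
proof (rule pres_cong_if_quotient)
  have "(rev [] @ u @ inv_word v, reduce n rs [] (u @ inv_word v)) \<in> pres_cong X R"
    by (rule pres_cong_reduce[OF assms(1)]) (simp_all add: assms(2,3))
  then show "(u @ inv_word v, []) \<in> pres_cong X R"
    by (simp add: assms(4))
qed


section \<open>Presentations of point stabilizers\<close>

definition run :: "('a \<times> bool \<Rightarrow> 'c \<Rightarrow> 'c) \<Rightarrow> 'a word \<Rightarrow> 'c \<Rightarrow> 'c"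
  where "run act w c = foldr act w c"

text \<open>Words act from their right end, so the label of the head is taken at the point reached
  by the tail. The result is the second component of \<open>w\<close> applied to
  \<open>(c, 1)\<close>.\<close>

fun cocycle ::
  "('a \<times> bool \<Rightarrow> 'c \<Rightarrow> 'c) \<Rightarrow> ('a \<times> bool \<Rightarrow> 'c \<Rightarrow> 'b word) \<Rightarrow> 'a word \<Rightarrow> 'c \<Rightarrow> 'b word" where
  "cocycle act lab [] c = []"
| "cocycle act lab (a # w) c = lab a (run act w c) @ cocycle act lab w c"

lemma run_simps [simp]:
  "run act [] c = c"
  "run act (a # w) c = act a (run act w c)"
  "run act (u @ v) c = run act u (run act v c)"
  by (simp_all add: run_def)

lemma cocycle_append [simp]:
  "cocycle act lab (u @ v) c = cocycle act lab u (run act v c) @ cocycle act lab v c"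
  by (induction u) auto

text \<open>
  The letters of the big group act on \<open>C \<times> presented_group Y Q\<close> by
  \<open>a \<cdot> (c, g) = (act a c, lab a c \<cdot> g)\<close>, which respects the relations. The orbit of \<open>(c\<^sub>0, 1)\<close>
  recovers \<open>g\<close> from its image in the big group; this gives injectivity. The elements \<open>t c\<close> form
  a transversal; rewriting along it gives surjectivity onto the stabilizer of \<open>c\<^sub>0\<close>.
\<close>

locale stabilizer_presentation =
  fixes X :: "'a set" and R :: "('a word \<times> 'a word) set"
    and Y :: "'b set" and Q :: "('b word \<times> 'b word) set"
    and \<phi> :: "'b \<Rightarrow> 'a word"
    and C :: "'c set" and c\<^sub>0 :: 'c
    and act :: "'a \<times> bool \<Rightarrow> 'c \<Rightarrow> 'c"
    and lab :: "'a \<times> bool \<Rightarrow> 'c \<Rightarrow> 'b word"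
    and t :: "'c \<Rightarrow> 'a word"
  assumes gen_words: "y \<in> Y \<Longrightarrow> \<phi> y \<in> words X"
    and gen_rel: "(w, w') \<in> Q \<Longrightarrow> (subst_word \<phi> w, subst_word \<phi> w') \<in> pres_cong X R"
    and rel_words: "(w, w') \<in> Q \<Longrightarrow> w \<in> words Y \<and> w' \<in> words Y"
    and base: "c\<^sub>0 \<in> C"
    and act_closed: "\<lbrakk>x \<in> X; c \<in> C\<rbrakk> \<Longrightarrow> act (x, b) c \<in> C"
    and lab_words: "\<lbrakk>x \<in> X; c \<in> C\<rbrakk> \<Longrightarrow> lab (x, b) c \<in> words Y"
    and act_cancel: "\<lbrakk>x \<in> X; c \<in> C\<rbrakk> \<Longrightarrow> act (x, b) (act (x, \<not> b) c) = c"
    and lab_cancel: "\<lbrakk>x \<in> X; c \<in> C\<rbrakk> \<Longrightarrow>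
      (lab (x, b) (act (x, \<not> b) c) @ lab (x, \<not> b) c, []) \<in> pres_cong Y Q"
    and act_rel: "\<lbrakk>(u, v) \<in> R; c \<in> C\<rbrakk> \<Longrightarrow> run act u c = run act v c"
    and lab_rel: "\<lbrakk>(u, v) \<in> R; c \<in> C\<rbrakk> \<Longrightarrow>
      (cocycle act lab u c, cocycle act lab v c) \<in> pres_cong Y Q"
    and t_words: "c \<in> C \<Longrightarrow> t c \<in> words X"
    and t_base: "t c\<^sub>0 = []"
    and t_step: "\<lbrakk>x \<in> X; c \<in> C\<rbrakk> \<Longrightarrow>
      ((x, b) # t c, t (act (x, b) c) @ subst_word \<phi> (lab (x, b) c)) \<in> pres_cong X R"
    and gen_act: "y \<in> Y \<Longrightarrow> run act (\<phi> y) c\<^sub>0 = c\<^sub>0"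
    and gen_lab: "y \<in> Y \<Longrightarrow> (cocycle act lab (\<phi> y) c\<^sub>0, [(y, True)]) \<in> pres_cong Y Q"
begin

abbreviation "stab_hom \<equiv> pres_lift (presented_group X R) (\<lambda>y. pres_class X R (\<phi> y))"

lemma run_closed: "\<lbrakk>u \<in> words X; c \<in> C\<rbrakk> \<Longrightarrow> run act u c \<in> C"
  by (induction u) (auto simp: act_closed)

lemma cocycle_words: "\<lbrakk>u \<in> words X; c \<in> C\<rbrakk> \<Longrightarrow> cocycle act lab u c \<in> words Y"
  by (induction u) (auto simp: lab_words run_closed)

text \<open>The action on pairs factors through the big group: the locale assumptions treat
  relations and cancelling pairs, and the cocycle rule carries congruence over to
  concatenations.\<close>

lemma cocycle_cong:
  assumes "(u, v) \<in> pres_cong X R" and "c \<in> C"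
  shows "run act u c = run act v c \<and> (cocycle act lab u c, cocycle act lab v c) \<in> pres_cong Y Q"
  using assms
proof (induction arbitrary: c rule: pres_cong.induct)
  case (relation u v)
  then show ?case using act_rel lab_rel by blast
next
  case (cancel x b)
  then show ?case using act_cancel lab_cancel by simp
next
  case (refl u)
  then show ?case using cocycle_words by (auto intro: pres_cong.refl)
next
  case (sym u v)
  then show ?case by (metis pres_cong.sym)
next
  case (trans u v w)
  then show ?case by (metis pres_cong.trans)
next
  case (append u u' v v')
  then have "run act v c \<in> C"
    using pres_cong_words run_closed by blast
  with append show ?case by (auto intro!: pres_cong.append)
qed

text \<open>Reading labels from the base point is a left inverse of substitution.\<close>

lemma cocycle_subst_word:
  assumes "w \<in> words Y"
  shows "run act (subst_word \<phi> w) c\<^sub>0 = c\<^sub>0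
    \<and> (cocycle act lab (subst_word \<phi> w) c\<^sub>0, w) \<in> pres_cong Y Q"
  using assms
proof (induction w)
  case (Cons a w)
  obtain y b where a: "a = (y, b)" by (cases a)
  have y: "y \<in> Y" using Cons.prems a by simp
  let ?u = "if b then \<phi> y else inv_word (\<phi> y)"
  have "run act ?u c\<^sub>0 = c\<^sub>0 \<and> (cocycle act lab ?u c\<^sub>0, [a]) \<in> pres_cong Y Q"
  proof (cases b)
    case True
    then show ?thesis using a y gen_act gen_lab by simp
  next
    case False
    \<comment> \<open>The label of an inverse generator is forced: the trivial word
      \<open>\<phi>(y)^{-1} \<phi>(y)\<close> has trivial label, and \<open>\<phi>(y)\<close>
      contributes \<open>y\<close>.\<close>
    have "(inv_word (\<phi> y) @ \<phi> y, []) \<in> pres_cong X R"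
      using gen_words[OF y] by (rule pres_cong_inv_word_left)
    from cocycle_cong[OF this base] gen_act[OF y]
    have *: "run act (inv_word (\<phi> y)) c\<^sub>0 = c\<^sub>0"
      "(cocycle act lab (inv_word (\<phi> y)) c\<^sub>0 @ cocycle act lab (\<phi> y) c\<^sub>0, []) \<in> pres_cong Y Q"
      by auto
    have "cocycle act lab (inv_word (\<phi> y)) c\<^sub>0 \<in> words Y"
      using cocycle_words gen_words[OF y] base by simp
    then have "(cocycle act lab (inv_word (\<phi> y)) c\<^sub>0 @ [(y, True)],
        cocycle act lab (inv_word (\<phi> y)) c\<^sub>0 @ cocycle act lab (\<phi> y) c\<^sub>0) \<in> pres_cong Y Q"
      by (intro pres_cong.append pres_cong.refl pres_cong.sym[OF gen_lab[OF y]])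
    then have "(cocycle act lab (inv_word (\<phi> y)) c\<^sub>0 @ inv_word [(y, False)], []) \<in> pres_cong Y Q"
      using *(2) by (auto intro: pres_cong.trans)
    from pres_cong_if_quotient[OF this] show ?thesis
      using *(1) False a by simp
  qed
  moreover have "run act (subst_word \<phi> w) c\<^sub>0 = c\<^sub>0"
    "(cocycle act lab (subst_word \<phi> w) c\<^sub>0, w) \<in> pres_cong Y Q"
    using Cons by auto
  ultimately show ?case
    using pres_cong.append[of "cocycle act lab ?u c\<^sub>0" "[a]" Y Q] a by simp
qed (simp add: pres_cong.refl)

text \<open>Reidemeister-Schreier rewriting: the letters of \<open>u\<close> are moved past the
  representative one at a time by \<open>t_step\<close>, each leaving its label behind.\<close>

lemma transversal_cocycle:
  assumes "u \<in> words X" and "c \<in> C"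
  shows "(u @ t c, t (run act u c) @ subst_word \<phi> (cocycle act lab u c)) \<in> pres_cong X R"
  using assms
proof (induction u)
  case Nil
  then show ?case by (simp add: pres_cong.refl t_words)
next
  case (Cons a u)
  obtain x b where a: "a = (x, b)" by (cases a)
  let ?c = "run act u c" and ?s = "subst_word \<phi> (cocycle act lab u c)"
  have x: "x \<in> X" and u: "u \<in> words X" and c: "?c \<in> C" using Cons.prems a run_closed by auto
  have s: "?s \<in> words X"
    by (rule subst_word_words[OF gen_words cocycle_words[OF u Cons.prems(2)]])
  have "([a] @ u @ t c, [a] @ t ?c @ ?s) \<in> pres_cong X R"
    using Cons.IH[OF u Cons.prems(2)] x a
    by (intro pres_cong.append[of "[a]" "[a]"] pres_cong.refl) simp_all
  moreover have "((a # t ?c) @ ?s, (t (act a ?c) @ subst_word \<phi> (lab a ?c)) @ ?s) \<in> pres_cong X R"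
    using t_step[OF x c, of b] a s by (intro pres_cong.append pres_cong.refl) simp_all
  ultimately show ?case
    using pres_cong.trans by fastforce
qed

lemma stab_hom_class:
  assumes "w \<in> words Y"
  shows "stab_hom (pres_class Y Q w) = pres_class X R (subst_word \<phi> w)"
    and "stab_hom \<in> hom (presented_group Y Q) (presented_group X R)"
proof -
  interpret group "presented_group X R" by (rule group_presented_group)
  have f: "(\<lambda>y. pres_class X R (\<phi> y)) \<in> Y \<rightarrow> carrier (presented_group X R)"
    using gen_words by (auto simp: carrier_presented_group)
  have rel: "word_val (presented_group X R) (\<lambda>y. pres_class X R (\<phi> y)) u
      = word_val (presented_group X R) (\<lambda>y. pres_class X R (\<phi> y)) v" if "(u, v) \<in> Q" for u v
    using gen_rel[OF that] rel_words[OF that] pres_cong_words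
    by (simp add: word_val_pres_class[OF gen_words] pres_class_eq subst_word_words[OF gen_words])
  show "stab_hom (pres_class Y Q w) = pres_class X R (subst_word \<phi> w)"
    using pres_lift_class[OF f rel assms] word_val_pres_class[OF gen_words assms] by simp
  show "stab_hom \<in> hom (presented_group Y Q) (presented_group X R)"
    by (rule pres_lift_hom(1)[OF f rel])
qed

lemma stab_hom_iso:
  "stab_hom \<in> iso (presented_group Y Q)
    ((presented_group X R)\<lparr>carrier := {pres_class X R u | u. u \<in> words X \<and> run act u c\<^sub>0 = c\<^sub>0}\<rparr>)"
    (is "_ \<in> iso ?P ?S")
proof -
  note words = subst_word_words[OF gen_words]
  have "stab_hom \<in> hom ?P ?S"
    using stab_hom_class(2)[of "[]"] words cocycle_subst_word
    by (fastforce simp: hom_def carrier_presented_group stab_hom_class(1))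
  moreover have "inj_on stab_hom (carrier ?P)"
  proof (rule inj_onI)
    fix A B assume "A \<in> carrier ?P" "B \<in> carrier ?P" and eq: "stab_hom A = stab_hom B"
    then obtain u v where uv: "u \<in> words Y" "v \<in> words Y"
        "A = pres_class Y Q u" "B = pres_class Y Q v"
      by (auto simp: carrier_presented_group)
    with eq have "(subst_word \<phi> u, subst_word \<phi> v) \<in> pres_cong X R"
      by (simp add: stab_hom_class(1) pres_class_eq words)
    \<comment> \<open>Congruent images have congruent labels at the base point, and these give back
      \<open>u\<close> and \<open>v\<close>.\<close>
    with cocycle_cong base
    have "(cocycle act lab (subst_word \<phi> u) c\<^sub>0, cocycle act lab (subst_word \<phi> v) c\<^sub>0) \<in> pres_cong Y Q"
      by blast
    with cocycle_subst_word uv have "(u, v) \<in> pres_cong Y Q"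
      by (meson pres_cong.sym pres_cong.trans)
    with uv show "A = B" by (simp add: pres_class_eq)
  qed
  moreover have "carrier ?S \<subseteq> stab_hom ` carrier ?P"
  proof
    fix A assume "A \<in> carrier ?S"
    then obtain u where u: "u \<in> words X" "run act u c\<^sub>0 = c\<^sub>0" "A = pres_class X R u"
      by auto
    \<comment> \<open>The preimage is the label of the loop \<open>u\<close>; the representatives at
      both of its ends are empty.\<close>
    let ?w = "cocycle act lab u c\<^sub>0"
    have w: "?w \<in> words Y" using cocycle_words u base by simp
    have "(u, subst_word \<phi> ?w) \<in> pres_cong X R"
      using transversal_cocycle[OF u(1) base] u(2) by (simp add: t_base)
    then have "A = stab_hom (pres_class Y Q ?w)"
      using u w by (simp add: stab_hom_class(1) pres_class_eq words)
    then show "A \<in> stab_hom ` carrier ?P"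
      using w by (auto simp: carrier_presented_group)
  qed
  ultimately show ?thesis
    by (auto simp: iso_def bij_betw_def hom_def)
qed

end


section \<open>The cactus group on four strands\<close>

abbreviation s1 :: "nat \<Rightarrow> (nat \<times> nat) \<times> bool"
  where "s1 q \<equiv> ((1, q), True)"

primrec pj4_word :: "pj4_symbol \<Rightarrow> (nat \<times> nat) word" where
  "pj4_word Alpha = [s1 3, s1 2, s1 3, s1 2, s1 3, s1 2]"
| "pj4_word Beta = [s1 2, s1 3, s1 4, s1 3, s1 4, s1 2, s1 4]"
| "pj4_word Gamma = [s1 2, s1 4, s1 2, s1 3, s1 4, s1 3, s1 4]"
| "pj4_word Delta = [s1 3, s1 2, s1 4, s1 2, s1 4, s1 3, s1 4]"
| "pj4_word Epsilon = [s1 4, s1 2, s1 3, s1 2, s1 4, s1 2, s1 3, s1 2]"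

text \<open>
  A permutation is written in one-line notation. The second components encode words in the
  \<open>s\<^sub>1\<^sub>,\<^sub>q\<close> by their indices \<open>q\<close>; they are the branches of a spanning tree of the Schreier graph.
\<close>

definition transversal :: "(nat list \<times> nat list) list"
  where "transversal =
    [([1, 2, 3, 4], []),
     ([2, 1, 3, 4], [2]),
     ([3, 2, 1, 4], [3]),
     ([4, 3, 2, 1], [4]),
     ([2, 3, 1, 4], [3, 2]),
     ([3, 4, 2, 1], [4, 2]),
     ([3, 1, 2, 4], [2, 3]),
     ([2, 3, 4, 1], [4, 3]),
     ([4, 3, 1, 2], [2, 4]),
     ([4, 1, 2, 3], [3, 4]),
     ([1, 3, 2, 4], [2, 3, 2]),
     ([3, 2, 4, 1], [4, 3, 2]),
     ([3, 4, 1, 2], [2, 4, 2]),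
     ([1, 4, 2, 3], [3, 4, 2]),
     ([2, 4, 3, 1], [4, 2, 3]),
     ([1, 3, 4, 2], [2, 4, 3]),
     ([2, 1, 4, 3], [3, 4, 3]),
     ([4, 1, 3, 2], [3, 2, 4]),
     ([1, 2, 4, 3], [4, 2, 4]),
     ([4, 2, 1, 3], [2, 3, 4]),
     ([1, 4, 3, 2], [4, 3, 4]),
     ([4, 2, 3, 1], [4, 2, 3, 2]),
     ([3, 1, 4, 2], [2, 4, 3, 2]),
     ([2, 4, 1, 3], [2, 3, 4, 2])]"

definition perms4 :: "nat list list"
  where "perms4 = map fst transversal"

definition coset_rep :: "nat list \<Rightarrow> (nat \<times> nat) word"
  where "coset_rep c = map s1 (the (map_of transversal c))"

text \<open>Left multiplication by a reversal acts on the values in the one-line notation. The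
  exponent is ignored because reversals are involutions.\<close>

definition perm_act :: "(nat \<times> nat) \<times> bool \<Rightarrow> nat list \<Rightarrow> nat list"
  where "perm_act a c = map (interval_reversal (fst a)) c"

text \<open>
  The entry at \<open>(q, c)\<close> expresses the Schreier generator
  \<open>(t (s\<^sub>1\<^sub>,\<^sub>q c))\<^sup>-\<^sup>1 s\<^sub>1\<^sub>,\<^sub>q (t c)\<close> in terms of \<open>\<alpha>, \<dots>, \<epsilon>\<close>. Each edge outside the spanning tree is
  listed in one of its two directions.
\<close>

definition schreier_table :: "((nat \<times> nat list) \<times> pj4_symbol word) list"
  where "schreier_table =
    [((3, [1, 3, 2, 4]), [(Alpha, True)]),
     ((4, [1, 4, 2, 3]), [(Gamma, False)]),
     ((3, [1, 3, 4, 2]), [(Beta, True), (Epsilon, True), (Alpha, False), (Delta, False)]),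
     ((4, [1, 3, 4, 2]), [(Delta, False)]),
     ((4, [2, 1, 4, 3]), [(Beta, False)]),
     ((2, [4, 1, 3, 2]), [(Epsilon, False)]),
     ((2, [1, 2, 4, 3]), [(Beta, True)]),
     ((3, [1, 2, 4, 3]), [(Beta, True)]),
     ((3, [4, 2, 1, 3]), [(Alpha, False)]),
     ((2, [1, 4, 3, 2]), [(Delta, True)]),
     ((3, [1, 4, 3, 2]), [(Gamma, True)]),
     ((3, [2, 4, 1, 3]), [(Alpha, True)]),
     ((4, [2, 4, 1, 3]), [(Epsilon, False), (Gamma, False)])]"

text \<open>An edge traversed backwards carries the inverse label; the default \<open>[]\<close>
  belongs to the edges of the spanning tree.\<close>

definition schreier_label :: "nat \<Rightarrow> nat list \<Rightarrow> pj4_symbol word"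
  where "schreier_label q c =
    (case map_of schreier_table (q, c) of
      Some w \<Rightarrow> w
    | None \<Rightarrow> (case map_of schreier_table (q, perm_act (s1 q) c) of
        Some w \<Rightarrow> inv_word w
      | None \<Rightarrow> []))"

text \<open>For \<open>p > 1\<close> this uses \<open>s\<^sub>p\<^sub>,\<^sub>q = s\<^sub>1\<^sub>,\<^sub>q s\<^sub>1\<^sub>,\<^sub>q\<^sub>+\<^sub>1\<^sub>-\<^sub>p s\<^sub>1\<^sub>,\<^sub>q\<close>.\<close>

definition perm_label :: "(nat \<times> nat) \<times> bool \<Rightarrow> nat list \<Rightarrow> pj4_symbol word"
  where "perm_label a c =
    (case fst a of (p, q) \<Rightarrow>
      if p = 1 then schreier_label q c
      else cocycle perm_act (\<lambda>b. schreier_label (snd (fst b))) [s1 q, s1 (q + 1 - p), s1 q] c)"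

definition gens4 :: "(nat \<times> nat) list"
  where "gens4 = [(1, 2), (1, 3), (1, 4), (2, 3), (2, 4), (3, 4)]"

definition nested4 :: "((nat \<times> nat) \<times> (nat \<times> nat)) list"
  where "nested4 =
    [((1, 4), (1, 2)), ((1, 4), (3, 4)), ((1, 4), (2, 3)), ((1, 4), (1, 3)), ((1, 4), (2, 4)),
     ((1, 3), (1, 2)), ((1, 3), (2, 3)), ((2, 4), (2, 3)), ((2, 4), (3, 4))]"

text \<open>
  The rules move \<open>s\<^sub>p\<^sub>,\<^sub>q\<close> to the right across the reversals of subintervals. They are not confluent,
  but they suffice for the words below.
\<close>

definition j4_rules :: "((nat \<times> nat) word \<times> (nat \<times> nat) word) list"
  where "j4_rules =
    map (\<lambda>x. ([(x, True), (x, True)], [])) gens4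
    @ map (\<lambda>((p, q), (m, r)).
        ([((m, r), True), ((p, q), True)], [((p + q - r, p + q - m), True), ((p, q), True)])) nested4
    @ [([((1, 2), True), ((3, 4), True)], [((1, 2), True), ((3, 4), True)])]
    @ map (\<lambda>x. ([(x, False)], [(x, True)])) gens4"

text \<open>Free cancellation, and deletion of the relator or its inverse starting at any of its ten
  letters.\<close>

definition pj4_rules :: "(pj4_symbol word \<times> pj4_symbol word) list"
  where "pj4_rules =
    concat (map (\<lambda>x. [([(x, True), (x, False)], []), ([(x, False), (x, True)], [])])
      [Alpha, Beta, Gamma, Delta, Epsilon])
    @ map (\<lambda>i. (rev (rotate i pj4_relator), [])) [0..<10]
    @ map (\<lambda>i. (rev (rotate i (inv_word pj4_relator)), [])) [0..<10]"


section \<open>Finite verifications by evaluation\<close>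

lemma cactus_gens_4: "cactus_gens 4 = set gens4"
proof -
  have "(p, q) \<in> cactus_gens 4 \<longleftrightarrow> (p, q) \<in> set gens4" for p q
    by (auto simp: cactus_gens_def gens4_def numeral_eq_Suc le_Suc_eq less_Suc_eq)
  then show ?thesis by auto
qed

lemma reduce_relator:
  "reduce 500 j4_rules [] (subst_word pj4_word pj4_relator @ inv_word []) = []"
  by code_simp

lemma perm_act_closed: "\<forall>c\<in>set perms4. \<forall>x\<in>set gens4. perm_act (x, True) c \<in> set perms4"
  by code_simp

text \<open>These are the identities \<open>s t(c) = t(s c) w_s(c)\<close> in J_4, one for each of
  the 24 permutations and 6 generators.\<close>

lemma reduce_transversal_step: "\<forall>c\<in>set perms4. \<forall>x\<in>set gens4.
  reduce 500 j4_rules [] (((x, True) # coset_rep c)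
    @ inv_word (coset_rep (perm_act (x, True) c)
      @ subst_word pj4_word (perm_label (x, True) c))) = []"
  by code_simp

lemma reduce_gens: "\<forall>y\<in>set [Alpha, Beta, Gamma, Delta, Epsilon].
  run perm_act (pj4_word y) [1, 2, 3, 4] = [1, 2, 3, 4]
  \<and> reduce 500 pj4_rules []
      (cocycle perm_act perm_label (pj4_word y) [1, 2, 3, 4] @ inv_word [(y, True)]) = []"
  by code_simp

text \<open>A computable sufficient condition for \<open>u\<close> and \<open>v\<close> to act alike
  on S_4 x P.\<close>

definition rel_check :: "(nat \<times> nat) word \<Rightarrow> (nat \<times> nat) word \<Rightarrow> bool"
  where "rel_check u v \<longleftrightarrow> (\<forall>c\<in>set perms4. run perm_act u c = run perm_act v c \<and>
     reduce 500 pj4_rules [] (cocycle perm_act perm_label u c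
       @ inv_word (cocycle perm_act perm_label v c)) = [])"

lemma rel_check_square: "\<forall>x\<in>set gens4. rel_check [(x, True), (x, True)] []"
  by code_simp

text \<open>Here and for nested intervals, the conditions on sets are replaced by inequalities
  between endpoints, which can be evaluated directly.\<close>

lemma rel_check_disjoint: "\<forall>(p, q)\<in>set gens4. \<forall>(m, r)\<in>set gens4. q < m \<or> r < p \<longrightarrow>
  rel_check [((p, q), True), ((m, r), True)] [((m, r), True), ((p, q), True)]"
  by code_simp

lemma rel_check_nested: "\<forall>(p, q)\<in>set gens4. \<forall>(m, r)\<in>set gens4. p \<le> m \<and> r \<le> q \<longrightarrow>
  rel_check [((p, q), True), ((m, r), True)] [((p + q - r, p + q - m), True), ((p, q), True)]"
  by code_simp

lemma coset_rep_gens: "\<forall>c\<in>set perms4. \<forall>a\<in>set (coset_rep c). fst a \<in> set gens4"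
  by code_simp

lemma perm_sign [simp]:
  "perm_act (x, False) = perm_act (x, True)" "perm_label (x, False) = perm_label (x, True)"
  by (auto simp: fun_eq_iff perm_act_def perm_label_def)

lemma words_UNIV [simp]: "w \<in> words UNIV"
  by (induction w) auto

section \<open>Soundness of the rewriting rules and of the checks\<close>

lemma cactus_square:
  assumes "x \<in> cactus_gens n"
  shows "([(x, True), (x, True)], []) \<in> pres_cong (cactus_gens n) (cactus_rels n)"
  using assms by (cases x) (auto simp: cactus_rels_def intro!: pres_cong.relation)

lemma cactus_inverse_letter:
  assumes "x \<in> cactus_gens n"
  shows "([(x, False)], [(x, True)]) \<in> pres_cong (cactus_gens n) (cactus_rels n)"
proof (rule pres_cong_if_quotient)
  show "([(x, False)] @ inv_word [(x, True)], []) \<in> pres_cong (cactus_gens n) (cactus_rels n)"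
    \<comment> \<open>The word to be trivialized consists of two inverse letters, the inverse of the
      square relator.\<close>
    using pres_cong_inv_word[OF cactus_square[OF assms]] by simp
qed

lemma cactus_disjoint:
  assumes "(p, q) \<in> cactus_gens n" and "(m, r) \<in> cactus_gens n" and "{p..q} \<inter> {m..r} = {}"
  shows "([((p, q), True), ((m, r), True)], [((m, r), True), ((p, q), True)])
    \<in> pres_cong (cactus_gens n) (cactus_rels n)"
  using assms by (intro pres_cong.relation) (auto simp: cactus_rels_def)

lemma cactus_nested:
  assumes "(p, q) \<in> cactus_gens n" and "(m, r) \<in> cactus_gens n" and "p \<le> m" and "r \<le> q"
  shows "([((p, q), True), ((m, r), True)], [((p + q - r, p + q - m), True), ((p, q), True)])
    \<in> pres_cong (cactus_gens n) (cactus_rels n)"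
proof (rule pres_cong.relation)
  have "{m..r} \<subseteq> {p..q}" using assms by simp
  then show "([((p, q), True), ((m, r), True)], [((p + q - r, p + q - m), True), ((p, q), True)])
      \<in> cactus_rels n"
    using assms(1,2) unfolding cactus_rels_def by blast
qed (use assms in \<open>auto simp: cactus_gens_def\<close>)

lemma j4_rules_sound:
  assumes "(l, r) \<in> set j4_rules"
  shows "(rev l, r) \<in> pres_cong (cactus_gens 4) (cactus_rels 4)"
proof -
  have nested: "(p, q) \<in> cactus_gens 4 \<and> (m, k) \<in> cactus_gens 4 \<and> p \<le> m \<and> k \<le> q"
    if "((p, q), (m, k)) \<in> set nested4" for p q m k
    using that by (auto simp: nested4_def cactus_gens_def)
  have "(3, 4) \<in> cactus_gens 4" "(1, 2) \<in> cactus_gens 4"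
    by (auto simp: cactus_gens_def)
  from cactus_disjoint[OF this]
  have disjoint: "([((3, 4), True), ((1, 2), True)], [((1, 2), True), ((3, 4), True)])
      \<in> pres_cong (cactus_gens 4) (cactus_rels 4)"
    by simp
  consider x where "x \<in> set gens4" "l = [(x, True), (x, True)]" "r = []"
    | p q m k where "((p, q), (m, k)) \<in> set nested4"
      "l = [((m, k), True), ((p, q), True)]" "r = [((p + q - k, p + q - m), True), ((p, q), True)]"
    | "l = [((1, 2), True), ((3, 4), True)]" "r = [((1, 2), True), ((3, 4), True)]"
    | x where "x \<in> set gens4" "l = [(x, False)]" "r = [(x, True)]"
    using assms unfolding j4_rules_def set_append set_map Un_iff by fastforce
  then show ?thesis
  proof cases
    case (1 x)
    then show ?thesis using cactus_square[of x 4] cactus_gens_4 by simp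
  next
    case (2 p q m k)
    then show ?thesis using cactus_nested[of p q 4 m k] nested[of p q m k] by simp
  next
    case 3
    then show ?thesis using disjoint by simp
  next
    case (4 x)
    then show ?thesis using cactus_inverse_letter[of x 4] cactus_gens_4 by simp
  qed
qed

lemma pj4_rules_sound:
  assumes "(l, r) \<in> set pj4_rules"
  shows "(rev l, r) \<in> pres_cong UNIV {(pj4_relator, [])}"
proof -
  have rel: "(pj4_relator, []) \<in> pres_cong UNIV {(pj4_relator, [])}"
    by (rule pres_cong.relation) auto
  then have inv_rel: "(inv_word pj4_relator, []) \<in> pres_cong UNIV {(pj4_relator, [])}"
    using pres_cong_inv_word by fastforce
  consider x b where "l = [(x, b), (x, \<not> b)]" "r = []"
    | i where "rev l = rotate i pj4_relator" "r = []"
    | i where "rev l = rotate i (inv_word pj4_relator)" "r = []"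
    using assms unfolding pj4_rules_def set_append Un_iff
    by (elim disjE) auto
  then show ?thesis
  proof cases
    case (1 x b)
    \<comment> \<open>Undoing the reversal of the left-hand side puts the letter of sign
      \<open>\<not> b\<close> first.\<close>
    then show ?thesis using pres_cong.cancel[of x UNIV "\<not> b"] by simp
  next
    case 2
    then show ?thesis using pres_cong_rotate[OF rel] by simp
  next
    case 3
    then show ?thesis using pres_cong_rotate[OF inv_rel] by simp
  qed
qed

lemma rel_check_sound:
  assumes "rel_check u v" and "c \<in> set perms4"
  shows "run perm_act u c = run perm_act v c"
    and "(cocycle perm_act perm_label u c, cocycle perm_act perm_label v c)
      \<in> pres_cong UNIV {(pj4_relator, [])}"
  using assms unfolding rel_check_def
  by (auto intro: pres_cong_if_reduce[OF pj4_rules_sound])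

lemma rel_check_cactus_rels:
  assumes "(u, v) \<in> cactus_rels 4"
  shows "rel_check u v"
proof -
  \<comment> \<open>The intervals are nonempty, so disjointness and inclusion can be read off their
    endpoints.\<close>
  have less: "p < q" if "(p, q) \<in> set gens4" for p q
    using that by (auto simp: gens4_def)
  show ?thesis
    using assms unfolding cactus_rels_def cactus_gens_4
  proof (elim UnE CollectE exE conjE)
    fix p q m r
    assume "(u, v) = ([((p, q), True), ((m, r), True)], [((m, r), True), ((p, q), True)])"
      and "(p, q) \<in> set gens4" "(m, r) \<in> set gens4" "{p..q} \<inter> {m..r} = {}"
    moreover from this have "q < m \<or> r < p"
      using less[of p q] less[of m r] by fastforce
    ultimately show ?thesis using rel_check_disjoint by fastforce
  next
    fix p q m r
    assume "(u, v) = ([((p, q), True), ((m, r), True)],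
        [((p + q - r, p + q - m), True), ((p, q), True)])"
      and "(p, q) \<in> set gens4" "(m, r) \<in> set gens4" "{m..r} \<subseteq> {p..q}"
    moreover from this have "p \<le> m \<and> r \<le> q"
      using less[of m r] by simp
    ultimately show ?thesis using rel_check_nested by fastforce
  qed (use rel_check_square in auto)
qed

section \<open>The pure cactus group as the stabilizer of the identity permutation\<close>

lemma pj4_symbol_UNIV: "y \<in> set [Alpha, Beta, Gamma, Delta, Epsilon]"
  by (cases y) auto

text \<open>Congruences in J_4 come from \<open>j4_rules\<close>, those in P from
  \<open>pj4_rules\<close>.\<close>

interpretation pj4: stabilizer_presentation "cactus_gens 4" "cactus_rels 4"
  UNIV "{(pj4_relator, [])}" pj4_word "set perms4" "[1, 2, 3, 4]" perm_act perm_label coset_rep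
proof
  show word: "pj4_word y \<in> words (cactus_gens 4)" for y
    by (cases y) (auto simp: cactus_gens_def)
  have coset_rep_words: "coset_rep c \<in> words (cactus_gens 4)" if "c \<in> set perms4" for c
    using coset_rep_gens that by (fastforce simp: words_def in_lists_conv_set cactus_gens_4)
  then show "coset_rep c \<in> words (cactus_gens 4)" if "c \<in> set perms4" for c
    using that .
  show "(subst_word pj4_word w, subst_word pj4_word w') \<in> pres_cong (cactus_gens 4) (cactus_rels 4)"
    if "(w, w') \<in> {(pj4_relator, [])}" for w w'
    using that reduce_relator subst_word_words[of UNIV pj4_word] word
    by (auto intro!: pres_cong_if_reduce[OF j4_rules_sound])
  show "[1, 2, 3, 4] \<in> set perms4"
    by (simp add: perms4_def transversal_def)
  show closed: "perm_act (x, b) c \<in> set perms4" if "x \<in> cactus_gens 4" "c \<in> set perms4" for x b c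
    using that perm_act_closed by (cases b) (auto simp: cactus_gens_4)
  show "perm_act (x, b) (perm_act (x, \<not> b) c) = c"
    and "(perm_label (x, b) (perm_act (x, \<not> b) c) @ perm_label (x, \<not> b) c, [])
      \<in> pres_cong UNIV {(pj4_relator, [])}"
    if "x \<in> cactus_gens 4" "c \<in> set perms4" for x b c
    \<comment> \<open>Action and labels do not see exponents, so cancelling pairs behave like the
      relation \<open>x x = 1\<close>.\<close>
    using that rel_check_square rel_check_sound[of "[(x, True), (x, True)]" "[]" c]
    by (cases b; auto simp: cactus_gens_4)+
  show "run perm_act u c = run perm_act v c"
    and "(cocycle perm_act perm_label u c, cocycle perm_act perm_label v c)
      \<in> pres_cong UNIV {(pj4_relator, [])}"
    if "(u, v) \<in> cactus_rels 4" "c \<in> set perms4" for u v c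
    using rel_check_sound[OF rel_check_cactus_rels] that by auto
  show "coset_rep [1, 2, 3, 4] = []"
    by (simp add: coset_rep_def transversal_def)
  show "((x, b) # coset_rep c,
        coset_rep (perm_act (x, b) c) @ subst_word pj4_word (perm_label (x, b) c))
      \<in> pres_cong (cactus_gens 4) (cactus_rels 4)"
    if x: "x \<in> cactus_gens 4" and c: "c \<in> set perms4" for x b c
  proof -
    let ?v = "coset_rep (perm_act (x, True) c) @ subst_word pj4_word (perm_label (x, True) c)"
    have *: "((x, True) # coset_rep c, ?v) \<in> pres_cong (cactus_gens 4) (cactus_rels 4)"
    proof (rule pres_cong_if_reduce[OF j4_rules_sound])
      show "reduce 500 j4_rules [] (((x, True) # coset_rep c) @ inv_word ?v) = []"
        using reduce_transversal_step x c cactus_gens_4 by blast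
    qed (use x c coset_rep_words closed word in \<open>auto intro: subst_word_words\<close>)
    \<comment> \<open>The evaluated identities have positive letters only; \<open>s^{-1} = s\<close>
      transfers them to inverse letters.\<close>
    have "([(x, False)] @ coset_rep c, [(x, True)] @ coset_rep c)
        \<in> pres_cong (cactus_gens 4) (cactus_rels 4)"
      by (intro pres_cong.append cactus_inverse_letter x pres_cong.refl coset_rep_words c)
    then show ?thesis
      using * by (cases b) (auto intro: pres_cong.trans)
  qed
  show "run perm_act (pj4_word y) [1, 2, 3, 4] = [1, 2, 3, 4]" for y
    using reduce_gens pj4_symbol_UNIV by blast
  show "(cocycle perm_act perm_label (pj4_word y) [1, 2, 3, 4], [(y, True)])
      \<in> pres_cong UNIV {(pj4_relator, [])}" for y
    using reduce_gens pj4_symbol_UNIV[of y] by (intro pres_cong_if_reduce[OF pj4_rules_sound]) auto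
qed (auto simp del: pj4_word.simps)

text \<open>This links the evaluated action on lists to the homomorphism onto permutations; inverse
  letters agree because each reversal is its own inverse.\<close>

lemma run_perm_act:
  assumes "u \<in> words (cactus_gens n)"
  shows "run perm_act u c = map (word_val (sym_group n) interval_reversal u) c"
  using assms
proof (induction u)
  case Nil
  then show ?case by (simp add: word_val_def sym_group_def)
next
  case (Cons a u)
  obtain x b where a: "a = (x, b)" by (cases a)
  interpret S: group "sym_group n" by (rule sym_group_is_group)
  have f: "interval_reversal x \<in> carrier (sym_group n)"
    using Cons.prems a interval_reversal_permutes[of "fst x" "snd x" n]
    by (simp add: sym_group_carrier del: One_nat_def)
  have "interval_reversal x \<otimes>\<^bsub>sym_group n\<^esub> interval_reversal x = \<one>\<^bsub>sym_group n\<^esub>"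
    by (cases x) (auto simp: interval_reversal_def sym_group_def fun_eq_iff)
  then have "inv\<^bsub>sym_group n\<^esub> interval_reversal x = interval_reversal x"
    using f by (intro S.inv_equality)
  then have "word_val (sym_group n) interval_reversal (a # u)
      = interval_reversal x \<circ> word_val (sym_group n) interval_reversal u"
    using a by (simp add: word_val_def sym_group_def)
  then show ?case
    using Cons a by (simp add: perm_act_def)
qed

lemma kernel_cactus_perm_4:
  "kernel J4 (sym_group 4) (cactus_perm 4)
    = {pres_class (cactus_gens 4) (cactus_rels 4) u | u.
        u \<in> words (cactus_gens 4) \<and> run perm_act u [1, 2, 3, 4] = [1, 2, 3, 4]}"
proof -
  interpret S: group "sym_group 4" by (rule sym_group_is_group)
  have f: "interval_reversal \<in> cactus_gens 4 \<rightarrow> carrier (sym_group 4)"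
    by (auto simp: sym_group_carrier simp del: One_nat_def intro: interval_reversal_permutes)
  have "cactus_perm 4 (pres_class (cactus_gens 4) (cactus_rels 4) u) = \<one>\<^bsub>sym_group 4\<^esub>
      \<longleftrightarrow> run perm_act u [1, 2, 3, 4] = [1, 2, 3, 4]"
    if u: "u \<in> words (cactus_gens 4)" for u
  proof -
    let ?\<sigma> = "word_val (sym_group 4) interval_reversal u"
    have "?\<sigma> permutes {1..4}"
      using S.word_val_closed[OF f u] by (simp add: sym_group_carrier)
    \<comment> \<open>Outside 1, ..., 4 nothing moves, so the one-line notation determines the
      permutation and the kernel is a stabilizer.\<close>
    then have "?\<sigma> i = i" if "i \<notin> {1, 2, 3, 4}" for i
      using that by (intro permutes_not_in) auto
    then have "?\<sigma> = id \<longleftrightarrow> map ?\<sigma> [1, 2, 3, 4] = [1, 2, 3, 4]"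
      by (auto simp: fun_eq_iff) metis
    then show ?thesis
      using S.pres_lift_class[OF f interval_reversal_cactus_rels u] run_perm_act[OF u]
      by (simp add: cactus_perm_def sym_group_def)
  qed
  then show ?thesis
    unfolding kernel_def cactus_group_def carrier_presented_group by auto
qed

lemma pj4_element_eq: "pj4_element y = pres_class (cactus_gens 4) (cactus_rels 4) (pj4_word y)"
proof -
  interpret J: group J4 by (rule group_cactus_group)
  have gens: "(1, 2) \<in> cactus_gens 4" "(1, 3) \<in> cactus_gens 4" "(1, 4) \<in> cactus_gens 4"
    by (auto simp: cactus_gens_def)
  show ?thesis
    using gens
    by (cases y) (simp_all add: numeral_eq_Suc cactus_gen_def pres_gen_def cactus_group_def
      mult_pres_class one_presented_group)
qed

theorem theoremA3:
  shows "\<exists>h \<in> iso (presented_group UNIV {(pj4_relator, [])}) (pure_cactus_group 4).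
           \<forall>x. h (pres_gen UNIV {(pj4_relator, [])} x) = pj4_element x"
proof (intro bexI[of _ pj4.stab_hom] allI)
  show "pj4.stab_hom \<in> iso (presented_group UNIV {(pj4_relator, [])}) (pure_cactus_group 4)"
    using pj4.stab_hom_iso
    unfolding pure_cactus_group_def kernel_cactus_perm_4 unfolding cactus_group_def .
  show "pj4.stab_hom (pres_gen UNIV {(pj4_relator, [])} x) = pj4_element x" for x
    unfolding pres_gen_def by (simp add: pj4.stab_hom_class(1) pj4_element_eq)
qed

end
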